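(* Let $p\ge1$ and let $\boldsymbol X$ be a random variable in $\mathbb R^d$ with finite $p$th moment and $P(\boldsymbol X=\boldsymbol 0)<1$. For $\sigma>0$ let $\mu_\sigma$ denote the distribution of $\sigma\boldsymbol X$, and let $\mu_b=\delta_{\boldsymbol 0}$ be the base measure, corresponding to $\sigma=0$. Let $C_p=(\mathbb E\|\boldsymbol X\|_{\mathbb R^d}^p)^{1/p}$. Then the $\mathrm{WCP}_p$ prior for $\sigma$ with hyperparameter $\eta>0$ is the exponential distribution with density $$\pi_p(\sigma)=\eta\,C_p\exp(-\eta\,C_p\,\sigma),\qquad \sigma>0.$$ Furthermore, after incorporating the finite constant $C_p$ into the user-specified parameter (i.e. writing $\eta$ for $\eta C_p$), the prior does not depend on $p$, and the $\mathrm{WCP}_p$ prior density for $\tau=1/\sigma^2$ is the Type-2 Gumbel density $$\pi_p(\tau)=\tfrac12\,\tau^{-3/2}\,\eta\,\exp(-\eta\,\tau^{-1/2}),\qquad \tau>0.$$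
   Context: Wasserstein distance on $\mathbb R^d$ (Euclidean norm $\|\cdot\|_{\mathbb R^d}$): $W_p(\mu,\nu)=\bigl(\inf_{\pi\in\Pi(\mu,\nu)}\int\|x-y\|^p\,d\pi(x,y)\bigr)^{1/p}$, $\Pi(\mu,\nu)$ the couplings of $\mu$ and $\nu$. One-sided univariate $\mathrm{WCP}_p$ prior. Let $\{\mu_\theta:\theta\in(\theta_-,\theta_+)\}$ be a model class with finite $p$th moments and base measure $\mu_b$ corresponding to a boundary value $\theta_b\in\{\theta_-,\theta_+\}$ of the parameter interval (possibly infinite). Put $W_p(\theta)=W_p(\mu_\theta,\mu_b)$ and $c=\sup_\theta W_p(\theta)\in(0,\infty]$. It is assumed that $\theta\mapsto W_p(\theta)$ is injective and differentiable, tends to $0$ as $\theta\to\theta_b$ and tends to $c$ at the other endpoint. For a hyperparameter $\eta>0$ the $\mathrm{WCP}_p$ prior density of $\theta$ is $$\pi(\theta)=\frac{\eta\,e^{-\eta W_p(\theta)}}{1-e^{-\eta c}}\left|\frac{dW_p(\theta)}{d\theta}\right|,\qquad e^{-\infty}:=0.$$ For the parameter $\tau=1/\sigma^2\in(0,\infty)$ the model is $\tau\mapsto\mu_{\tau^{-1/2}}$ with the same base measure $\delta_{\boldsymbol 0}$, corresponding to $\tau_b=\infty$. *)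

theory Defs
  imports "HOL-Probability.Probability"
begin

definition couplings :: "'a measure \<Rightarrow> 'b measure \<Rightarrow> ('a \<times> 'b) measure set" where
  "couplings \<mu> \<nu> = {\<pi>. prob_space \<pi> \<and> sets \<pi> = sets (\<mu> \<Otimes>\<^sub>M \<nu>) \<and>
     distr \<pi> \<mu> fst = \<mu> \<and> distr \<pi> \<nu> snd = \<nu>}"

text \<open>Because of \<^const>\<open>enn2real\<close>, the following is meaningful only if the infimum is finite, for
  instance if both measures have a finite \<open>p\<close>th moment.\<close>

definition wasserstein ::
  "real \<Rightarrow> 'a::euclidean_space measure \<Rightarrow> 'a measure \<Rightarrow> real" where
  "wasserstein p \<mu> \<nu> =
     enn2real (INF \<pi>\<in>couplings \<mu> \<nu>. \<integral>\<^sup>+ z. ennreal (norm (fst z - snd z) powr p) \<partial>\<pi>) powr (1 / p)"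

definition finite_moment :: "real \<Rightarrow> 'a::euclidean_space measure \<Rightarrow> bool" where
  "finite_moment p \<mu> \<longleftrightarrow>
     prob_space \<mu> \<and> sets \<mu> = sets borel \<and> integrable \<mu> (\<lambda>x. norm x powr p)"

definition wcp_sup ::
  "real \<Rightarrow> ereal \<Rightarrow> ereal \<Rightarrow> (real \<Rightarrow> 'a::euclidean_space measure) \<Rightarrow> 'a measure \<Rightarrow> ereal" where
  "wcp_sup p \<theta>\<^sub>m \<theta>\<^sub>p \<mu> \<mu>\<^sub>b = (SUP \<theta>\<in>einterval \<theta>\<^sub>m \<theta>\<^sub>p. ereal (wasserstein p (\<mu> \<theta>) \<mu>\<^sub>b))"

text \<open>The one-sided setting: the parameter interval is \<open>einterval \<theta>\<^sub>m \<theta>\<^sub>p\<close> with possibly infinite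
  endpoints, and \<open>\<theta>\<^sub>b\<close> is the endpoint that corresponds to the base measure. The limits at the
  endpoints are taken in \<^typ>\<open>ereal\<close> to cover finite and infinite endpoints uniformly.\<close>

locale one_sided_wcp =
  fixes p :: real
    and \<theta>\<^sub>m \<theta>\<^sub>p \<theta>\<^sub>b :: ereal
    and \<mu> :: "real \<Rightarrow> 'a::euclidean_space measure"
    and \<mu>\<^sub>b :: "'a measure"
  assumes p_ge_1: "1 \<le> p"
    and interval: "\<theta>\<^sub>m < \<theta>\<^sub>p"
    and boundary: "\<theta>\<^sub>b \<in> {\<theta>\<^sub>m, \<theta>\<^sub>p}"
    and model_moment: "\<theta> \<in> einterval \<theta>\<^sub>m \<theta>\<^sub>p \<Longrightarrow> finite_moment p (\<mu> \<theta>)"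
    and base_moment: "finite_moment p \<mu>\<^sub>b"
    and sup_pos: "0 < wcp_sup p \<theta>\<^sub>m \<theta>\<^sub>p \<mu> \<mu>\<^sub>b"
    and inj: "inj_on (\<lambda>\<theta>. wasserstein p (\<mu> \<theta>) \<mu>\<^sub>b) (einterval \<theta>\<^sub>m \<theta>\<^sub>p)"
    and differentiable: "\<theta> \<in> einterval \<theta>\<^sub>m \<theta>\<^sub>p \<Longrightarrow>
      (\<lambda>\<theta>. wasserstein p (\<mu> \<theta>) \<mu>\<^sub>b) differentiable (at \<theta>)"
    and limit_base: "((\<lambda>x. wasserstein p (\<mu> (real_of_ereal x)) \<mu>\<^sub>b) \<longlongrightarrow> 0)
      (at \<theta>\<^sub>b within {\<theta>\<^sub>m<..<\<theta>\<^sub>p})"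
    and limit_other: "((\<lambda>x. ereal (wasserstein p (\<mu> (real_of_ereal x)) \<mu>\<^sub>b)) \<longlongrightarrow> wcp_sup p \<theta>\<^sub>m \<theta>\<^sub>p \<mu> \<mu>\<^sub>b)
      (at (if \<theta>\<^sub>b = \<theta>\<^sub>m then \<theta>\<^sub>p else \<theta>\<^sub>m) within {\<theta>\<^sub>m<..<\<theta>\<^sub>p})"

definition exp_minus_ereal :: "real \<Rightarrow> ereal \<Rightarrow> real" where
  "exp_minus_ereal \<eta> c = (if c = \<infinity> then 0 else exp (- \<eta> * real_of_ereal c))"

definition wcp_density ::
  "real \<Rightarrow> ereal \<Rightarrow> ereal \<Rightarrow> (real \<Rightarrow> 'a::euclidean_space measure) \<Rightarrow> 'a measure \<Rightarrow> real \<Rightarrow> real \<Rightarrow> real"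
  where
  "wcp_density p \<theta>\<^sub>m \<theta>\<^sub>p \<mu> \<mu>\<^sub>b \<eta> \<theta> =
     \<eta> * exp (- \<eta> * wasserstein p (\<mu> \<theta>) \<mu>\<^sub>b) / (1 - exp_minus_ereal \<eta> (wcp_sup p \<theta>\<^sub>m \<theta>\<^sub>p \<mu> \<mu>\<^sub>b))
       * \<bar>deriv (\<lambda>t. wasserstein p (\<mu> t) \<mu>\<^sub>b) \<theta>\<bar>"

text \<open>\<^const>\<open>wcp_density\<close> is a density on the open parameter interval only; its values elsewhere
  carry no meaning.\<close>

definition wcp_prior ::
  "real \<Rightarrow> ereal \<Rightarrow> ereal \<Rightarrow> (real \<Rightarrow> 'a::euclidean_space measure) \<Rightarrow> 'a measure \<Rightarrow> real \<Rightarrow> real measure"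
  where
  "wcp_prior p \<theta>\<^sub>m \<theta>\<^sub>p \<mu> \<mu>\<^sub>b \<eta> =
     density lborel (\<lambda>\<theta>. ennreal
       (indicator (einterval \<theta>\<^sub>m \<theta>\<^sub>p) \<theta> * wcp_density p \<theta>\<^sub>m \<theta>\<^sub>p \<mu> \<mu>\<^sub>b \<eta> \<theta>))"

definition scale_model ::
  "'w measure \<Rightarrow> ('w \<Rightarrow> 'a::euclidean_space) \<Rightarrow> real \<Rightarrow> 'a measure" where
  "scale_model M X \<sigma> = distr M borel (\<lambda>\<omega>. \<sigma> *\<^sub>R X \<omega>)"

definition precision_model ::
  "'w measure \<Rightarrow> ('w \<Rightarrow> 'a::euclidean_space) \<Rightarrow> real \<Rightarrow> 'a measure" where
  "precision_model M X \<tau> = scale_model M X (\<tau> powr (- 1 / 2))"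

definition moment_const ::
  "'w measure \<Rightarrow> ('w \<Rightarrow> 'a::euclidean_space) \<Rightarrow> real \<Rightarrow> real" where
  "moment_const M X p = (\<integral>\<omega>. norm (X \<omega>) powr p \<partial>M) powr (1 / p)"

text \<open>Type-2 Gumbel distribution with shape \<open>a\<close> and scale \<open>b\<close>.\<close>

definition type2_gumbel_density :: "real \<Rightarrow> real \<Rightarrow> real \<Rightarrow> real" where
  "type2_gumbel_density a b x =
     (if x \<le> 0 then 0 else a * b * x powr (- a - 1) * exp (- b * x powr (- a)))"

end

(* A coupling with a Dirac mass at 0 has second marginal 0 almost surely, so every coupling has the
   same transport cost, namely the p-th moment. Hence W_p is C_p * sigma in the scale
   parametrisation and C_p * tau^(-1/2) in the precision parametrisation; both are unbounded, so the
   normalising constant of the prior is 1, and the densities are read off by differentiation. *)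
theory Submission
  imports Defs "HOL-Real_Asymp.Real_Asymp"
begin

section \<open>Optimal transport to the Dirac mass at 0\<close>

lemma coupling_cost_return_0:
  fixes \<mu> :: "'a::euclidean_space measure"
  assumes sets_\<mu>: "sets \<mu> = sets borel" and \<pi>: "\<pi> \<in> couplings \<mu> (return borel 0)"
  shows "(\<integral>\<^sup>+ z. ennreal (norm (fst z - snd z) powr p) \<partial>\<pi>) = (\<integral>\<^sup>+ x. ennreal (norm x powr p) \<partial>\<mu>)"
proof -
  have sets_\<pi>: "sets \<pi> = sets (\<mu> \<Otimes>\<^sub>M return borel (0::'a))"
    and fst_\<pi>: "distr \<pi> \<mu> fst = \<mu>"
    and snd_\<pi>: "distr \<pi> (return borel 0) snd = return borel (0::'a)"
    using \<pi> unfolding couplings_def by auto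
  have m_fst: "fst \<in> measurable \<pi> \<mu>" and m_snd: "snd \<in> measurable \<pi> (return borel (0::'a))"
    using measurable_fst measurable_snd measurable_cong_sets[OF sets_\<pi> refl] by blast+
  have "AE y in distr \<pi> (return borel 0) snd. y = (0::'a)"
    unfolding snd_\<pi> by (subst AE_return) auto
  then have ae: "AE z in \<pi>. snd z = 0"
    by (subst (asm) AE_distr_iff[OF m_snd]) auto
  have "(\<integral>\<^sup>+ z. ennreal (norm (fst z - snd z) powr p) \<partial>\<pi>) = (\<integral>\<^sup>+ z. ennreal (norm (fst z) powr p) \<partial>\<pi>)"
    by (rule nn_integral_cong_AE) (use ae in auto)
  also have "\<dots> = (\<integral>\<^sup>+ x. ennreal (norm x powr p) \<partial>distr \<pi> \<mu> fst)"
    by (subst nn_integral_distr[OF m_fst]) (auto simp: measurable_cong_sets[OF sets_\<mu> refl])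
  finally show ?thesis unfolding fst_\<pi> .
qed

text \<open>Guards the infimum in \<open>wasserstein\<close>: over an empty set it would be
  infinite, and \<open>enn2real\<close> would turn it into 0. The witness is the product coupling,
  written as the push-forward under \<open>x \<mapsto> (x, 0)\<close> so that both marginals are
  compositions.\<close>

lemma couplings_return_nonempty:
  fixes \<mu> :: "'a::euclidean_space measure"
  assumes "prob_space \<mu>" "sets \<mu> = sets borel"
  shows "couplings \<mu> (return borel (0::'a)) \<noteq> {}"
proof -
  interpret prob_space \<mu> by fact
  let ?\<nu> = "return borel (0::'a)"
  let ?\<pi> = "distr \<mu> (\<mu> \<Otimes>\<^sub>M ?\<nu>) (\<lambda>x. (x, 0))"
  have m: "(\<lambda>x. (x, 0)) \<in> measurable \<mu> (\<mu> \<Otimes>\<^sub>M ?\<nu>)"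
    by (intro measurable_Pair) auto
  have "distr ?\<pi> \<mu> fst = \<mu>"
    by (subst distr_distr[OF measurable_fst m]) (auto simp: comp_def distr_id)
  moreover have "distr ?\<pi> ?\<nu> snd = ?\<nu>"
  proof -
    have "distr ?\<pi> ?\<nu> snd = distr \<mu> ?\<nu> (\<lambda>x. 0)"
      by (subst distr_distr[OF measurable_snd m]) (auto simp: comp_def)
    \<comment> \<open>\<open>distr_const\<close> yields the Dirac measure over \<open>?\<nu>\<close>
      instead of \<open>borel\<close>; \<open>return\<close> depends only on the sigma-algebra, so
      the two agree.\<close>
    also have "\<dots> = return ?\<nu> 0" by (rule distr_const) simp
    also have "\<dots> = ?\<nu>" by (rule return_cong) simp
    finally show ?thesis .
  qed
  ultimately have "?\<pi> \<in> couplings \<mu> ?\<nu>"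
    unfolding couplings_def by (auto intro: prob_space_distr m)
  then show ?thesis by blast
qed

lemma wasserstein_return_0:
  fixes \<mu> :: "'a::euclidean_space measure"
  assumes "finite_moment p \<mu>"
  shows "wasserstein p \<mu> (return borel 0) = (\<integral>x. norm x powr p \<partial>\<mu>) powr (1 / p)"
proof -
  have \<mu>: "prob_space \<mu>" "sets \<mu> = sets borel" "integrable \<mu> (\<lambda>x. norm x powr p)"
    using assms unfolding finite_moment_def by auto
  have "(INF \<pi>\<in>couplings \<mu> (return borel 0). \<integral>\<^sup>+ z. ennreal (norm (fst z - snd z) powr p) \<partial>\<pi>)
      = (\<integral>\<^sup>+ x. ennreal (norm x powr p) \<partial>\<mu>)"
    \<comment> \<open>The infimum of a constant over a nonempty set is that constant.\<close>
    using couplings_return_nonempty[OF \<mu>(1,2)] coupling_cost_return_0[OF \<mu>(2)]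
    by (simp cong: INF_cong)
  \<comment> \<open>The moment is finite, so \<open>enn2real\<close> in \<open>wasserstein\<close>
    recovers the integral.\<close>
  also have "\<dots> = ennreal (\<integral>x. norm x powr p \<partial>\<mu>)"
    by (rule nn_integral_eq_integral[OF \<mu>(3)]) simp
  finally show ?thesis unfolding wasserstein_def by simp
qed

lemma finite_moment_return_0: "finite_moment p (return borel (0::'a::euclidean_space))"
proof -
  have "integrable (return borel (0::'a)) (\<lambda>x. norm x powr p)"
    \<comment> \<open>Under the Dirac mass the integrand is almost surely \<open>0 powr p\<close>,
      which is 0 for every \<open>p\<close>.\<close>
    by (subst integrable_cong_AE[where g="\<lambda>_. 0"]) (auto simp: AE_return)
  then show ?thesis
    unfolding finite_moment_def by (auto intro: prob_space_return)
qed

lemma finite_moment_scale_model: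
  fixes X :: "'w \<Rightarrow> 'a::euclidean_space"
  assumes "prob_space M" and X[measurable]: "X \<in> borel_measurable M"
    and int: "integrable M (\<lambda>\<omega>. norm (X \<omega>) powr p)" and "0 \<le> \<sigma>"
  shows "finite_moment p (scale_model M X \<sigma>)"
proof -
  interpret prob_space M by fact
  have "integrable M (\<lambda>\<omega>. \<sigma> powr p * norm (X \<omega>) powr p)"
    using int by simp
  then have "integrable M (\<lambda>\<omega>. norm (\<sigma> *\<^sub>R X \<omega>) powr p)"
    using \<open>0 \<le> \<sigma>\<close> by (simp add: powr_mult)
  then show ?thesis
    unfolding finite_moment_def scale_model_def
    by (auto intro!: prob_space_distr simp: integrable_distr_eq)
qed

text \<open>Homogeneity of the norm pulls \<open>\<sigma> powr p\<close> out of the moment; the p-th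
  root then turns this factor into \<open>\<sigma>\<close>, which is where
  \<open>p \<noteq> 0\<close> enters.\<close>

lemma wasserstein_scale_model:
  fixes X :: "'w \<Rightarrow> 'a::euclidean_space"
  assumes "prob_space M" and X[measurable]: "X \<in> borel_measurable M"
    and int: "integrable M (\<lambda>\<omega>. norm (X \<omega>) powr p)" and "0 \<le> \<sigma>" and "p \<noteq> 0"
  shows "wasserstein p (scale_model M X \<sigma>) (return borel 0) = moment_const M X p * \<sigma>"
proof -
  have "(\<integral>x. norm x powr p \<partial>scale_model M X \<sigma>) = (\<integral>\<omega>. norm (\<sigma> *\<^sub>R X \<omega>) powr p \<partial>M)"
    unfolding scale_model_def by (subst integral_distr) auto
  also have "\<dots> = \<sigma> powr p * (\<integral>\<omega>. norm (X \<omega>) powr p \<partial>M)"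
    using \<open>0 \<le> \<sigma>\<close> by (simp add: powr_mult)
  finally show ?thesis
    using assms finite_moment_scale_model[OF assms(1-4)]
    by (simp add: wasserstein_return_0 moment_const_def powr_mult powr_powr)
qed

lemma moment_const_pos:
  fixes X :: "'w \<Rightarrow> 'a::euclidean_space"
  assumes "prob_space M" and X[measurable]: "X \<in> borel_measurable M"
    and int: "integrable M (\<lambda>\<omega>. norm (X \<omega>) powr p)"
    and "measure M {\<omega> \<in> space M. X \<omega> = 0} < 1"
  shows "0 < moment_const M X p"
proof -
  interpret prob_space M by fact
  have "(\<integral>\<omega>. norm (X \<omega>) powr p \<partial>M) \<noteq> 0"
  proof
    assume "(\<integral>\<omega>. norm (X \<omega>) powr p \<partial>M) = 0"
    \<comment> \<open>A nonnegative function with zero integral vanishes almost everywhere, and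
      \<open>powr\<close> vanishes exactly where its base does, whatever the exponent.\<close>
    then have "AE \<omega> in M. X \<omega> = 0"
      by (subst (asm) integral_nonneg_eq_0_iff_AE[OF int]) auto
    then have "prob {\<omega> \<in> space M. X \<omega> = 0} = 1"
      by (subst prob_Collect_eq_1) auto
    with assms show False by simp
  qed
  moreover have "0 \<le> (\<integral>\<omega>. norm (X \<omega>) powr p \<partial>M)" by simp
  ultimately show ?thesis unfolding moment_const_def by simp
qed

section \<open>Unbounded distances on the parameter interval from 0 to infinity\<close>

lemma einterval_0_PInf: "einterval 0 \<infinity> = {0<..}"
  by (auto simp: einterval_def zero_ereal_def)

text \<open>The limits in \<open>one_sided_wcp\<close> are taken in \<open>ereal\<close>. This lemma
  and its counterpart at infinity translate them into real limits: close to one endpoint the other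
  bound is invisible.\<close>

lemma at_0_within_pos_ereal: "at (0::ereal) within {0<..<\<infinity>} = filtermap ereal (at_right 0)"
proof -
  have "at (0::ereal) within {0<..<\<infinity>} = at_right 0"
    by (rule at_within_nhd[of _ "{..<\<infinity>}"]) auto
  then show ?thesis using at_right_ereal[of 0] by (simp add: zero_ereal_def)
qed

lemma at_PInf_within_pos_ereal: "at (\<infinity>::ereal) within {0<..<\<infinity>} = filtermap ereal at_top"
proof -
  have "at (\<infinity>::ereal) within {0<..<\<infinity>} = at_left \<infinity>"
    by (rule at_within_nhd[of _ "{0<..}"]) auto
  then show ?thesis by (simp add: at_left_PInf)
qed

lemma wcp_sup_0_PInf:
  assumes "\<And>\<theta>. 0 < \<theta> \<Longrightarrow> wasserstein p (\<mu> \<theta>) \<nu> = g \<theta>"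
    and "\<And>y. 0 < y \<Longrightarrow> \<exists>\<theta>>0. y \<le> g \<theta>"
  shows "wcp_sup p 0 \<infinity> \<mu> \<nu> = \<infinity>"
  unfolding wcp_sup_def einterval_0_PInf
proof (rule SUP_PInfty)
  fix n :: nat
  \<comment> \<open>The shift by 1 makes the threshold positive also for \<open>n = 0\<close>, as
    the second assumption demands.\<close>
  obtain \<theta> where "0 < \<theta>" "real n + 1 \<le> g \<theta>" using assms(2)[of "real n + 1"] by auto
  then show "\<exists>\<theta>\<in>{0<..}. ereal (real n) \<le> ereal (wasserstein p (\<mu> \<theta>) \<nu>)"
    using assms(1) by force
qed

text \<open>Differentiation is local, so a closed form \<open>g\<close> known only on the open
  positive half-line suffices.\<close>

lemma DERIV_wasserstein_pos:
  assumes "\<And>\<theta>. 0 < \<theta> \<Longrightarrow> wasserstein p (\<mu> \<theta>) \<nu> = g \<theta>"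
    and "(g has_real_derivative d) (at \<theta>)" "0 < \<theta>"
  shows "((\<lambda>t. wasserstein p (\<mu> t) \<nu>) has_real_derivative d) (at \<theta>)"
proof (rule has_field_derivative_transform_within_open[OF assms(2)])
  show "open {0::real<..}" by simp
qed (use assms in auto)

lemma wcp_density_unbounded:
  assumes "\<And>\<theta>. 0 < \<theta> \<Longrightarrow> wasserstein p (\<mu> \<theta>) \<nu> = g \<theta>"
    and "\<And>y. 0 < y \<Longrightarrow> \<exists>\<theta>>0. y \<le> g \<theta>"
    and "(g has_real_derivative d) (at \<theta>)" "0 < \<theta>"
  shows "wcp_density p 0 \<infinity> \<mu> \<nu> \<eta> \<theta> = \<eta> * exp (- \<eta> * g \<theta>) * \<bar>d\<bar>"
  using wcp_sup_0_PInf[OF assms(1,2)] DERIV_imp_deriv[OF DERIV_wasserstein_pos[OF assms(1,3,4)]] assms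
  by (simp add: wcp_density_def exp_minus_ereal_def)

text \<open>The value of \<open>f\<close> at 0 is left free because a point is Lebesgue-null. This
  freedom matters for \<open>exponential_density\<close>, which equals its rate at 0, while the
  prior is cut off there by the indicator of the open interval.\<close>

lemma wcp_prior_eq_density:
  assumes "\<And>\<theta>. 0 < \<theta> \<Longrightarrow> wcp_density p 0 \<infinity> \<mu> \<nu> \<eta> \<theta> = f \<theta>" and [measurable]: "f \<in> borel_measurable borel"
    and "\<And>\<theta>. \<theta> < 0 \<Longrightarrow> f \<theta> = 0"
  shows "wcp_prior p 0 \<infinity> \<mu> \<nu> \<eta> = density lborel (\<lambda>\<theta>. ennreal (f \<theta>))"
proof -
  have "(\<lambda>\<theta>. ennreal (indicator (einterval 0 \<infinity>) \<theta> * wcp_density p 0 \<infinity> \<mu> \<nu> \<eta> \<theta>))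
      = (\<lambda>\<theta>. ennreal (indicator {0<..} \<theta> * f \<theta>))"
    using assms(1) by (auto simp: einterval_0_PInf indicator_def fun_eq_iff)
  moreover have "density lborel (\<lambda>\<theta>. ennreal (indicator {0<..} \<theta> * f \<theta>)) = density lborel (\<lambda>\<theta>. ennreal (f \<theta>))"
  proof (rule density_cong)
    show "AE \<theta> in lborel. ennreal (indicator {0<..} \<theta> * f \<theta>) = ennreal (f \<theta>)"
      using AE_lborel_singleton[of 0]
    proof eventually_elim
      case (elim \<theta>)
      then show ?case using assms(3)[of \<theta>] by (cases "\<theta> < 0") (auto simp: indicator_def)
    qed
  qed auto
  ultimately show ?thesis unfolding wcp_prior_def by simp
qed


section \<open>Densities and priors for the scale and the precision\<close>

theorem proposition2:
  fixes M :: "'w measure"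
    and X :: "'w \<Rightarrow> real ^ 'd"
    and p \<eta> :: real
  assumes "1 \<le> p"
    and "0 < \<eta>"
    and "prob_space M"
    and "X \<in> borel_measurable M"
    and "integrable M (\<lambda>\<omega>. norm (X \<omega>) powr p)"
    and "measure M {\<omega> \<in> space M. X \<omega> = 0} < 1"
  shows
    "one_sided_wcp p 0 \<infinity> 0 (scale_model M X) (return borel 0)
     \<and> (\<forall>\<sigma>>0. wcp_density p 0 \<infinity> (scale_model M X) (return borel 0) \<eta> \<sigma>
           = \<eta> * moment_const M X p * exp (- \<eta> * moment_const M X p * \<sigma>))
     \<and> wcp_prior p 0 \<infinity> (scale_model M X) (return borel 0) \<eta>
           = density lborel (\<lambda>\<sigma>. ennreal (exponential_density (\<eta> * moment_const M X p) \<sigma>))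
     \<and> 0 < moment_const M X p
     \<and> (\<forall>\<sigma>>0. wcp_density p 0 \<infinity> (scale_model M X) (return borel 0) (\<eta> / moment_const M X p) \<sigma>
           = \<eta> * exp (- \<eta> * \<sigma>))
     \<and> (\<forall>q\<ge>1. integrable M (\<lambda>\<omega>. norm (X \<omega>) powr q) \<longrightarrow>
           wcp_prior q 0 \<infinity> (scale_model M X) (return borel 0) (\<eta> / moment_const M X q)
             = wcp_prior p 0 \<infinity> (scale_model M X) (return borel 0) (\<eta> / moment_const M X p)
           \<and> wcp_prior q 0 \<infinity> (precision_model M X) (return borel 0) (\<eta> / moment_const M X q)
             = wcp_prior p 0 \<infinity> (precision_model M X) (return borel 0) (\<eta> / moment_const M X p))
     \<and> one_sided_wcp p 0 \<infinity> \<infinity> (precision_model M X) (return borel 0)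
     \<and> (\<forall>\<tau>>0. wcp_density p 0 \<infinity> (precision_model M X) (return borel 0) (\<eta> / moment_const M X p) \<tau>
           = 1 / 2 * \<tau> powr (- 3 / 2) * \<eta> * exp (- \<eta> * \<tau> powr (- 1 / 2)))
     \<and> wcp_prior p 0 \<infinity> (precision_model M X) (return borel 0) (\<eta> / moment_const M X p)
           = density lborel (\<lambda>\<tau>. ennreal (type2_gumbel_density (1 / 2) \<eta> \<tau>))"
proof -
  let ?S = "scale_model M X" and ?T = "precision_model M X" and ?\<nu> = "return borel (0 :: real ^ 'd)"
  let ?C = "moment_const M X"
  \<comment> \<open>The exponent \<open>q\<close> is kept general in the facts on \<open>?C\<close>,
    distances, densities and priors, since independence of the exponent compares two of
    them.\<close>
  have C_pos: "0 < ?C q" if "integrable M (\<lambda>\<omega>. norm (X \<omega>) powr q)" for q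
    using moment_const_pos assms that by blast
  have W_S: "wasserstein q (?S \<sigma>) ?\<nu> = ?C q * \<sigma>"
    if "1 \<le> q" "integrable M (\<lambda>\<omega>. norm (X \<omega>) powr q)" "0 < \<sigma>" for q \<sigma>
    using wasserstein_scale_model[of M X q \<sigma>] assms that by simp
  have W_T: "wasserstein q (?T \<tau>) ?\<nu> = ?C q * \<tau> powr (- 1 / 2)"
    if "1 \<le> q" "integrable M (\<lambda>\<omega>. norm (X \<omega>) powr q)" "0 < \<tau>" for q \<tau>
    using W_S[of q "\<tau> powr (- 1 / 2)"] that by (simp add: precision_model_def)
  have unb_S: "\<exists>\<sigma>>0. y \<le> c * \<sigma>" if "0 < c" "0 < y" for c y :: real
    using that by (intro exI[of _ "y / c"]) auto
  \<comment> \<open>The witness solves \<open>c * \<tau> powr (- 1 / 2) = y\<close>, just as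
    \<open>y / c\<close> does in the linear case above.\<close>
  have unb_T: "\<exists>\<tau>>0. y \<le> c * \<tau> powr (- 1 / 2)" if "0 < c" "0 < y" for c y :: real
    using that by (intro exI[of _ "(y / c) powr (- 2)"]) (auto simp: powr_powr)
  have D_S: "((*) c has_real_derivative c) (at \<sigma>)" for c \<sigma> :: real
    by (auto intro!: derivative_eq_intros)
  have D_T: "((\<lambda>\<tau>. c * \<tau> powr (- 1 / 2)) has_real_derivative - (c / 2 * \<tau> powr (- 3 / 2))) (at \<tau>)"
    if "0 < \<tau>" for c \<tau> :: real
    using that by (auto intro!: derivative_eq_intros)
  have dens_S: "wcp_density q 0 \<infinity> ?S ?\<nu> \<alpha> \<sigma> = \<alpha> * ?C q * exp (- \<alpha> * ?C q * \<sigma>)"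
    if "1 \<le> q" "integrable M (\<lambda>\<omega>. norm (X \<omega>) powr q)" "0 < \<sigma>" for q \<alpha> \<sigma>
    using wcp_density_unbounded[OF W_S[OF that(1,2)] unb_S[OF C_pos[OF that(2)]] D_S that(3), of \<alpha>]
      C_pos[OF that(2)] by (simp add: mult_ac)
  \<comment> \<open>Dividing the hyperparameter by \<open>?C q\<close> expresses that the constant
    is absorbed: it cancels both in the exponent and against the derivative. The derivative is
    negative, and the absolute value in \<open>wcp_density\<close> removes its sign.\<close>
  have dens_T: "wcp_density q 0 \<infinity> ?T ?\<nu> (\<alpha> / ?C q) \<tau>
      = 1 / 2 * \<tau> powr (- 3 / 2) * \<alpha> * exp (- \<alpha> * \<tau> powr (- 1 / 2))"
    if "1 \<le> q" "integrable M (\<lambda>\<omega>. norm (X \<omega>) powr q)" "0 < \<tau>" for q \<alpha> \<tau>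
    using wcp_density_unbounded[OF W_T[OF that(1,2)] unb_T[OF C_pos[OF that(2)]] D_T[OF that(3)] that(3),
        of "\<alpha> / ?C q"] C_pos[OF that(2)] by (simp add: abs_mult)
  have prior_S: "wcp_prior q 0 \<infinity> ?S ?\<nu> \<alpha>
      = density lborel (\<lambda>\<sigma>. ennreal (exponential_density (\<alpha> * ?C q) \<sigma>))"
    if "1 \<le> q" "integrable M (\<lambda>\<omega>. norm (X \<omega>) powr q)" for q \<alpha>
    using dens_S[OF that] by (intro wcp_prior_eq_density) (auto simp: exponential_density_def mult_ac)
  have prior_T: "wcp_prior q 0 \<infinity> ?T ?\<nu> (\<alpha> / ?C q)
      = density lborel (\<lambda>\<tau>. ennreal (type2_gumbel_density (1 / 2) \<alpha> \<tau>))"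
    if "1 \<le> q" "integrable M (\<lambda>\<omega>. norm (X \<omega>) powr q)" for q \<alpha>
  proof (rule wcp_prior_eq_density)
    show "type2_gumbel_density (1 / 2) \<alpha> \<in> borel_measurable borel"
      unfolding type2_gumbel_density_def by measurable
  qed (use dens_T[OF that] in \<open>auto simp: type2_gumbel_density_def\<close>)

  \<comment> \<open>The one-sided setting for both parametrisations\<close>
  have sup_S: "wcp_sup p 0 \<infinity> ?S ?\<nu> = \<infinity>"
    using wcp_sup_0_PInf[OF W_S unb_S] assms C_pos by blast
  have sup_T: "wcp_sup p 0 \<infinity> ?T ?\<nu> = \<infinity>"
    using wcp_sup_0_PInf[OF W_T unb_T] assms C_pos by blast
  note C = C_pos[OF assms(5)] and WS = W_S[OF assms(1,5)] and WT = W_T[OF assms(1,5)]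
  have pos: "\<forall>\<^sub>F x in at_right 0. (0::real) < x" "\<forall>\<^sub>F x in at_top. (0::real) < x"
    by (auto simp: eventually_at_right_less eventually_gt_at_top)
  have model_S: "one_sided_wcp p 0 \<infinity> 0 ?S ?\<nu>"
  proof
    show "inj_on (\<lambda>\<sigma>. wasserstein p (?S \<sigma>) ?\<nu>) (einterval 0 \<infinity>)"
      unfolding einterval_0_PInf using C by (auto simp: inj_on_def WS)
    show "(\<lambda>\<sigma>. wasserstein p (?S \<sigma>) ?\<nu>) differentiable at \<sigma>" if "\<sigma> \<in> einterval 0 \<infinity>" for \<sigma>
      using that DERIV_wasserstein_pos[OF WS D_S, of \<sigma>]
      by (auto simp: einterval_0_PInf real_differentiable_def)
    show "finite_moment p (?S \<sigma>)" if "\<sigma> \<in> einterval 0 \<infinity>" for \<sigma>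
      using that assms by (auto simp: einterval_0_PInf intro: finite_moment_scale_model)
    have "((*) (?C p) \<longlongrightarrow> 0) (at_right 0)"
      by (auto intro!: tendsto_eq_intros)
    \<comment> \<open>The closed form is available only for positive parameters, so limits are first
      computed for it and then transferred by eventual equality.\<close>
    moreover have "\<forall>\<^sub>F \<sigma> in at_right 0. ?C p * \<sigma> = wasserstein p (?S \<sigma>) ?\<nu>"
      using pos(1) by eventually_elim (simp add: WS)
    ultimately have "((\<lambda>\<sigma>. wasserstein p (?S \<sigma>) ?\<nu>) \<longlongrightarrow> 0) (at_right 0)"
      by (rule Lim_transform_eventually)
    then show "((\<lambda>x. wasserstein p (?S (real_of_ereal x)) ?\<nu>) \<longlongrightarrow> 0) (at 0 within {0<..<\<infinity>})"
      by (simp add: at_0_within_pos_ereal filterlim_filtermap)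
    have "filterlim ((*) (?C p)) at_top at_top"
      using C by (intro filterlim_tendsto_pos_mult_at_top[OF tendsto_const]) (auto simp: filterlim_ident)
    moreover have "\<forall>\<^sub>F \<sigma> in at_top. ?C p * \<sigma> = wasserstein p (?S \<sigma>) ?\<nu>"
      using pos(2) by eventually_elim (simp add: WS)
    ultimately have "filterlim (\<lambda>\<sigma>. wasserstein p (?S \<sigma>) ?\<nu>) at_top at_top"
      using filterlim_cong by fast
    then show "((\<lambda>x. ereal (wasserstein p (?S (real_of_ereal x)) ?\<nu>)) \<longlongrightarrow> wcp_sup p 0 \<infinity> ?S ?\<nu>)
        (at (if (0::ereal) = 0 then \<infinity> else 0) within {0<..<\<infinity>})"
      by (simp add: at_PInf_within_pos_ereal filterlim_filtermap sup_S tendsto_PInfty_eq_at_top)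
  qed (use assms sup_S finite_moment_return_0 in auto)
  have model_T: "one_sided_wcp p 0 \<infinity> \<infinity> ?T ?\<nu>"
  proof
    \<comment> \<open>The inverse of \<open>\<tau> powr (- 1 / 2)\<close> on positive arguments is
      \<open>y powr (- 2)\<close>.\<close>
    have "inj_on (\<lambda>\<tau>::real. \<tau> powr (- 1 / 2)) {0<..}"
      by (rule inj_on_inverseI[where g="\<lambda>y. y powr (- 2)"]) (auto simp: powr_powr)
    then show "inj_on (\<lambda>\<tau>. wasserstein p (?T \<tau>) ?\<nu>) (einterval 0 \<infinity>)"
      unfolding einterval_0_PInf using C by (auto simp: inj_on_def WT)
    show "(\<lambda>\<tau>. wasserstein p (?T \<tau>) ?\<nu>) differentiable at \<tau>" if "\<tau> \<in> einterval 0 \<infinity>" for \<tau>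
      using that DERIV_wasserstein_pos[OF WT D_T, of \<tau>]
      by (auto simp: einterval_0_PInf real_differentiable_def)
    \<comment> \<open>No sign condition on \<open>\<tau>\<close> arises: the scale
      \<open>\<tau> powr (- 1 / 2)\<close> is always nonnegative.\<close>
    show "finite_moment p (?T \<tau>)" for \<tau>
      unfolding precision_model_def using assms by (auto intro: finite_moment_scale_model)
    \<comment> \<open>The endpoints swap roles compared with the scale: the base measure sits at
      infinity, and the distance blows up at 0.\<close>
    have "((\<lambda>\<tau>. ?C p * \<tau> powr (- 1 / 2)) \<longlongrightarrow> 0) at_top"
      by (intro tendsto_mult_right_zero tendsto_neg_powr) (auto simp: filterlim_ident)
    moreover have "\<forall>\<^sub>F \<tau> in at_top. ?C p * \<tau> powr (- 1 / 2) = wasserstein p (?T \<tau>) ?\<nu>"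
      using pos(2) by eventually_elim (simp add: WT)
    ultimately have "((\<lambda>\<tau>. wasserstein p (?T \<tau>) ?\<nu>) \<longlongrightarrow> 0) at_top"
      by (rule Lim_transform_eventually)
    then show "((\<lambda>x. wasserstein p (?T (real_of_ereal x)) ?\<nu>) \<longlongrightarrow> 0) (at \<infinity> within {0<..<\<infinity>})"
      by (simp add: at_PInf_within_pos_ereal filterlim_filtermap)
    have "filterlim (\<lambda>\<tau>. ?C p * \<tau> powr (- 1 / 2)) at_top (at_right 0)"
    proof (intro filterlim_tendsto_pos_mult_at_top[OF tendsto_const C])
      show "filterlim (\<lambda>\<tau>::real. \<tau> powr (- 1 / 2)) at_top (at_right 0)" by real_asymp
    qed
    moreover have "\<forall>\<^sub>F \<tau> in at_right 0. ?C p * \<tau> powr (- 1 / 2) = wasserstein p (?T \<tau>) ?\<nu>"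
      using pos(1) by eventually_elim (simp add: WT)
    ultimately have "filterlim (\<lambda>\<tau>. wasserstein p (?T \<tau>) ?\<nu>) at_top (at_right 0)"
      using filterlim_cong by fast
    then show "((\<lambda>x. ereal (wasserstein p (?T (real_of_ereal x)) ?\<nu>)) \<longlongrightarrow> wcp_sup p 0 \<infinity> ?T ?\<nu>)
        (at (if \<infinity> = (0::ereal) then \<infinity> else 0) within {0<..<\<infinity>})"
      by (simp add: at_0_within_pos_ereal filterlim_filtermap sup_T tendsto_PInfty_eq_at_top)
  qed (use assms sup_T finite_moment_return_0 in auto)
  have cancel: "\<eta> / ?C q * ?C q = \<eta>" if "integrable M (\<lambda>\<omega>. norm (X \<omega>) powr q)" for q
    using C_pos[OF that] by simp
  \<comment> \<open>Once each hyperparameter is divided by its own moment constant, both sides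
    reduce to one explicit law in which no exponent occurs.\<close>
  have indep: "wcp_prior q 0 \<infinity> ?S ?\<nu> (\<eta> / ?C q) = wcp_prior p 0 \<infinity> ?S ?\<nu> (\<eta> / ?C p)
      \<and> wcp_prior q 0 \<infinity> ?T ?\<nu> (\<eta> / ?C q) = wcp_prior p 0 \<infinity> ?T ?\<nu> (\<eta> / ?C p)"
    if "1 \<le> q" "integrable M (\<lambda>\<omega>. norm (X \<omega>) powr q)" for q
    unfolding prior_S[OF that] prior_T[OF that] prior_S[OF assms(1,5)] prior_T[OF assms(1,5)]
      cancel[OF that(2)] cancel[OF assms(5)] by simp
  have dens_S': "wcp_density p 0 \<infinity> ?S ?\<nu> (\<eta> / ?C p) \<sigma> = \<eta> * exp (- \<eta> * \<sigma>)" if "0 < \<sigma>" for \<sigma>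
    using dens_S[OF assms(1,5) that, of "\<eta> / ?C p"] C by simp
  show ?thesis
    using model_S model_T dens_S[OF assms(1,5)] dens_S' dens_T[OF assms(1,5)]
      prior_S[OF assms(1,5)] prior_T[OF assms(1,5)] indep C by blast
qed

end
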